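(* Let $U\subset\mathbb R^n$ ($n\ge2$) be a bounded domain with $C^1$ boundary $\Gamma$, let $\gamma_1,\gamma_2>0$ be two functions on $U$, and let $r,q$ be numbers with $r>2$ and $r>q\ge1$. Suppose $\mathring X^{r,q}_{\gamma_1,\gamma_2}(U)$ is a class of functions on $U$ vanishing on $\Gamma$ and $c_0>0$ is a constant such that $$\|u\|_{L^r_{\gamma_1}(U)}\le c_0\|\nabla u\|_{L^q_{\gamma_2}(U)}\quad\text{for all }u\in\mathring X^{r,q}_{\gamma_1,\gamma_2}(U).$$ Set $$p=2+q\Big(1-\frac2r\Big)=q+2\Big(1-\frac qr\Big).$$ If $T>0$ and $u(x,t)\in\mathring X^{r,q}_{\gamma_1,\gamma_2}(Q_T)$, then $$\|u\|_{L^p_{\gamma_1}(Q_T)}\le c_0^{\frac qp}\Big(\operatorname*{ess\,sup}_{0<t<T}\|u(t)\|_{L^2_{\gamma_1}(U)}\Big)^{1-\frac qp}\|\nabla u\|_{L^q_{\gamma_2}(Q_T)}^{\frac qp}.$$ Consequently, $$\|u\|_{L^p_{\gamma_1}(Q_T)}\le c_0^{\frac qp}\Big(\operatorname*{ess\,sup}_{0<t<T}\|u(t)\|_{L^2_{\gamma_1}(U)}+\|\nabla u\|_{L^q_{\gamma_2}(Q_T)}\Big).$$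
   Context: $Q_T=U\times(0,T)$, $u(t)=u(\cdot,t)$, and $\nabla$ is the spatial gradient. $\mathring X^{r,q}_{\gamma_1,\gamma_2}(Q_T)$ denotes the set of functions $u(x,t)$ such that $u(\cdot,t)\in\mathring X^{r,q}_{\gamma_1,\gamma_2}(U)$ for almost all $t\in(0,T)$. For a weight $f\ge0$ on $U$, $L^s_f(U)$ is the $L^s$ space on $U$ with respect to the measure $f(x)\,dx$; for $E\subset U\times\mathbb R$, $L^s_f(E)$ is the $L^s$ space on $E$ with respect to the measure $f\,dx\,dt$. *)

theory Defs
  imports "HOL-Analysis.Analysis" "HOL-Probability.Essential_Supremum"
begin

definition C1_gradient :: "('a::euclidean_space \<Rightarrow> real) \<Rightarrow> ('a \<Rightarrow> 'a) \<Rightarrow> bool" where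
  "C1_gradient f f' \<longleftrightarrow> (\<forall>x. GDERIV f x :> f' x) \<and> continuous_on UNIV f'"

text \<open>Near each boundary point the domain is the strict epigraph, in some direction \<open>\<nu>\<close>, of a
  \<open>C\<^sup>1\<close> function \<open>h\<close> of the coordinates orthogonal to \<open>\<nu>\<close>.\<close>

definition C1_boundary :: "'a::euclidean_space set \<Rightarrow> bool" where
  "C1_boundary U \<longleftrightarrow>
     (\<forall>x0 \<in> frontier U. \<exists>\<rho>>0. \<exists>\<nu> h h'. norm \<nu> = 1 \<and> C1_gradient h h' \<and>
        U \<inter> ball x0 \<rho> = {x \<in> ball x0 \<rho>. x \<bullet> \<nu> > h (x - (x \<bullet> \<nu>) *\<^sub>R \<nu>)})"

definition bounded_C1_domain :: "'a::euclidean_space set \<Rightarrow> bool" where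
  "bounded_C1_domain U \<longleftrightarrow> open U \<and> connected U \<and> U \<noteq> {} \<and> bounded U \<and> C1_boundary U"

definition has_weak_gradient ::
    "'a::euclidean_space set \<Rightarrow> ('a \<Rightarrow> real) \<Rightarrow> ('a \<Rightarrow> 'a) \<Rightarrow> bool" where
  "has_weak_gradient U u g \<longleftrightarrow>
     (\<forall>K. compact K \<and> K \<subseteq> U \<longrightarrow> set_integrable lebesgue K u \<and> set_integrable lebesgue K g) \<and>
     (\<forall>\<phi> \<phi>'. C1_gradient \<phi> \<phi>' \<and> compact (closure {x. \<phi> x \<noteq> 0}) \<and> closure {x. \<phi> x \<noteq> 0} \<subseteq> U \<longrightarrow>
        (LINT x:U|lebesgue. u x *\<^sub>R \<phi>' x) = - (LINT x:U|lebesgue. \<phi> x *\<^sub>R g x))"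

text \<open>Zero boundary values in the sense of traces. The boundary layer of width \<open>\<epsilon>\<close> has volume of
  order \<open>\<epsilon>\<close>; the part of it on which \<open>\<bar>u\<bar> > \<delta>\<close> is required to have volume \<open>o(\<epsilon>)\<close>, for every
  \<open>\<delta> > 0\<close>. On a bounded \<open>C\<^sup>1\<close> domain this is \<open>u = 0\<close> on the boundary for functions continuous up to
  the boundary, and zero trace for \<open>u\<close> in \<open>W\<^sup>1\<^sup>,\<^sup>1\<close>. It presupposes no integrability of \<open>u\<close> or of its
  gradient up to the boundary, which the weighted norms below do not provide.\<close>

definition vanishes_on_boundary :: "'a::euclidean_space set \<Rightarrow> ('a \<Rightarrow> real) \<Rightarrow> bool" where
  "vanishes_on_boundary U u \<longleftrightarrow>
     (\<forall>\<delta>>0. ((\<lambda>\<epsilon>. measure lebesgue {x \<in> U. infdist x (frontier U) < \<epsilon> \<and> \<bar>u x\<bar> > \<delta>} / \<epsilon>)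
        \<longlongrightarrow> 0) (at_right 0))"

text \<open>Used only for exponents \<open>a > 0\<close>.\<close>

definition enn_powr :: "ennreal \<Rightarrow> real \<Rightarrow> ennreal" where
  "enn_powr x a = (if x = \<infinity> then \<infinity> else ennreal (enn2real x powr a))"

text \<open>The norm of \<open>L\<^sup>s\<close> on \<open>E\<close> with respect to the measure with Lebesgue density \<open>w\<close>; its value
  is \<open>\<infinity>\<close> if \<open>v\<close> is not in that space.\<close>

definition wLnorm ::
    "real \<Rightarrow> ('a::euclidean_space \<Rightarrow> real) \<Rightarrow> 'a set \<Rightarrow> ('a \<Rightarrow> 'b::real_normed_vector) \<Rightarrow> ennreal" where
  "wLnorm s w E v =
     enn_powr (\<integral>\<^sup>+x. ennreal (norm (v x) powr s) \<partial>density (lebesgue_on E) (\<lambda>x. ennreal (w x))) (1 / s)"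

definition parabolic_cylinder :: "'a set \<Rightarrow> real \<Rightarrow> ('a \<times> real) set" where
  "parabolic_cylinder U T = U \<times> {0<..<T}"

definition parabolic_class :: "('a \<Rightarrow> real) set \<Rightarrow> real \<Rightarrow> ('a \<times> real \<Rightarrow> real) set" where
  "parabolic_class X T = {u. AE t in lebesgue_on {0<..<T}. (\<lambda>x. u (x, t)) \<in> X}"

definition has_spatial_weak_gradient ::
    "'a::euclidean_space set \<Rightarrow> real \<Rightarrow> ('a \<times> real \<Rightarrow> real) \<Rightarrow> ('a \<times> real \<Rightarrow> 'a) \<Rightarrow> bool" where
  "has_spatial_weak_gradient U T u G \<longleftrightarrow>
     G \<in> borel_measurable (lebesgue_on (parabolic_cylinder U T)) \<and>
     (AE t in lebesgue_on {0<..<T}. has_weak_gradient U (\<lambda>x. u (x, t)) (\<lambda>x. G (x, t)))"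

end

theory Submission
  imports Defs
begin

text \<open>
  Put \<open>a = q / r\<close>, so that \<open>0 < a < 1\<close> and \<open>p = 2 * (1 - a) + r * a\<close> with \<open>r * a = q\<close>. At a fixed
  time, Hoelder's inequality for the measure of density \<open>\<gamma>1\<close> with the conjugate exponents
  \<open>1 / (1 - a)\<close> and \<open>1 / a\<close>, applied to \<open>\<bar>u\<bar>\<^sup>p = (\<bar>u\<bar>\<^sup>2)\<^sup>1\<^sup>-\<^sup>a (\<bar>u\<bar>\<^sup>r)\<^sup>a\<close>, bounds the \<open>p\<close>-th power of the
  \<open>L\<^sup>p\<close> norm by the \<open>(p - q)\<close>-th power of the \<open>L\<^sup>2\<close> norm times the \<open>q\<close>-th power of the \<open>L\<^sup>r\<close> norm
  (\<open>wLnorm_interpolation\<close>). The exponent \<open>p\<close> is chosen so that the \<open>L\<^sup>r\<close> norm enters with exactly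
  the power \<open>q\<close>: the assumed Sobolev-type inequality turns it into \<open>c0\<^sup>q\<close> times the \<open>q\<close>-th power
  of the gradient norm, which is the quantity that integrates over time to the gradient norm on
  the cylinder. The \<open>L\<^sup>2\<close> factor is bounded by its essential supremum. Integrating over \<open>(0, T)\<close>
  and taking \<open>p\<close>-th roots gives the first inequality; the second follows because a weighted
  geometric mean of two numbers is at most their sum.

  The whole argument runs in the extended nonnegative reals, with \<open>0 * \<infinity> = 0\<close>. Hoelder's
  inequality remains true under this convention, since a vanishing integral forces its integrand
  to vanish almost everywhere. In particular the estimate covers the case of a zero gradient norm
  together with an infinite essential supremum. The essential supremum of a non-measurable function
  is \<open>\<infinity>\<close> by definition, so it is always an almost everywhere upper bound.

  What remains is the passage between the cylinder and its time slices (\<open>wLnorm_cylinder\<close>).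
  Lebesgue measure on a product is not the product of the Lebesgue measures but its completion.
  Tonelli's theorem is therefore transferred from Borel functions: a Lebesgue measurable function
  agrees almost everywhere with a Borel function, and almost every slice of a null set is null.
\<close>

section \<open>Real powers of extended nonnegative reals\<close>

lemma enn_powr_ennreal: "0 \<le> x \<Longrightarrow> enn_powr (ennreal x) a = ennreal (x powr a)"
  by (simp add: enn_powr_def)

lemma enn_powr_top [simp]: "enn_powr top a = top"
  by (simp add: enn_powr_def)

lemma enn_powr_0 [simp]: "enn_powr 0 a = 0"
  by (simp add: enn_powr_def)

lemma enn_powr_1 [simp]: "enn_powr x 1 = x"
  by (cases x) (auto simp: enn_powr_ennreal)

lemma enn_powr_eq_0_iff [simp]: "enn_powr x a = 0 \<longleftrightarrow> x = 0"
  by (cases x) (auto simp: enn_powr_ennreal)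

lemma enn_powr_eq_top_iff [simp]: "enn_powr x a = top \<longleftrightarrow> x = top"
  by (cases x) (auto simp: enn_powr_ennreal)

lemma enn_powr_enn_powr: "enn_powr (enn_powr x a) b = enn_powr x (a * b)"
  by (cases x) (auto simp: enn_powr_ennreal powr_powr)

lemma enn_powr_mult: "enn_powr (x * y) a = enn_powr x a * enn_powr y a"
  by (cases x; cases y)
     (auto simp: enn_powr_ennreal powr_mult ennreal_mult_top ennreal_top_mult simp flip: ennreal_mult)

lemma enn_powr_mono: "x \<le> y \<Longrightarrow> 0 \<le> a \<Longrightarrow> enn_powr x a \<le> enn_powr y a"
  by (cases x; cases y) (auto simp: enn_powr_ennreal powr_mono2 intro!: ennreal_leI simp: top_unique)

lemma enn_powr_add: "enn_powr x a * enn_powr x b = enn_powr x (a + b)"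
  by (cases x) (auto simp: enn_powr_ennreal powr_add simp flip: ennreal_mult)

lemma measurable_enn_powr [measurable]: "(\<lambda>x. enn_powr x a) \<in> borel_measurable borel"
  unfolding enn_powr_def by measurable

section \<open>Hoelder's inequality and interpolation of weighted norms\<close>
lemma enn_powr_Young:
  assumes a: "0 < a" "a < 1"
  shows "enn_powr f (1 - a) * enn_powr g a \<le> ennreal (1 - a) * f + ennreal a * g"
proof (cases "f = 0 \<or> g = 0 \<or> f = top \<or> g = top")
  case True
  then show ?thesis using a by (auto simp: ennreal_mult_top ennreal_eq_0_iff)
next
  case False
  then obtain x y where xy: "f = ennreal x" "g = ennreal y" "0 < x" "0 < y"
    by (cases f; cases g) (auto simp: less_le)
  have "x powr (1 - a) * y powr a \<le> (1 - a) * x + a * y"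
    by (rule Youngs_inequality_0) (use a xy in auto)
  then show ?thesis
    using a xy by (simp add: enn_powr_ennreal flip: ennreal_mult ennreal_plus)
qed

text \<open>If both integrals are finite and nonzero, the inequality of Young is applied to the
  normalised functions. If an integral vanishes, so does the left-hand side; otherwise an infinite
  integral makes the right-hand side infinite.\<close>
lemma nn_integral_Hoelder:
  assumes [measurable]: "f \<in> borel_measurable M" "g \<in> borel_measurable M"
    and a: "0 < a" "a < 1"
  shows "(\<integral>\<^sup>+x. enn_powr (f x) (1 - a) * enn_powr (g x) a \<partial>M)
           \<le> enn_powr (\<integral>\<^sup>+x. f x \<partial>M) (1 - a) * enn_powr (\<integral>\<^sup>+x. g x \<partial>M) a"
proof -
  define F G where "F = (\<integral>\<^sup>+x. f x \<partial>M)" and "G = (\<integral>\<^sup>+x. g x \<partial>M)"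
  consider "F = 0 \<or> G = 0" | "F \<noteq> 0" "G \<noteq> 0" "F = top \<or> G = top"
    | "F \<noteq> 0" "G \<noteq> 0" "F \<noteq> top" "G \<noteq> top" by auto
  then show ?thesis
  proof cases
    case 1
    then have "(AE x in M. f x = 0) \<or> (AE x in M. g x = 0)"
      unfolding F_def G_def by (auto simp: nn_integral_0_iff_AE)
    then have "AE x in M. enn_powr (f x) (1 - a) * enn_powr (g x) a = 0"
      by auto
    then have "(\<integral>\<^sup>+x. enn_powr (f x) (1 - a) * enn_powr (g x) a \<partial>M) = 0"
      by (subst nn_integral_0_iff_AE) auto
    then show ?thesis by simp
  next
    case 2
    then show ?thesis
      unfolding F_def[symmetric] G_def[symmetric] by (auto simp: ennreal_mult_eq_top_iff)
  next
    case 3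
    let ?C = "enn_powr F (1 - a) * enn_powr G a"
    \<comment> \<open>Division by \<open>H\<close> can be undone in the extended reals only for \<open>0 < H < \<infinity>\<close>.\<close>
    have div: "h = H * (h / H)" if "H \<noteq> 0" "H \<noteq> top" for h H :: ennreal
      using that mult_divide_eq_ennreal[of H h] by (simp add: ennreal_times_divide mult.commute)
    have "(\<integral>\<^sup>+x. enn_powr (f x) (1 - a) * enn_powr (g x) a \<partial>M)
        \<le> (\<integral>\<^sup>+x. ?C * (ennreal (1 - a) * (f x / F) + ennreal a * (g x / G)) \<partial>M)"
    proof (rule nn_integral_mono)
      fix x
      have "enn_powr (f x) (1 - a) * enn_powr (g x) a
          = ?C * (enn_powr (f x / F) (1 - a) * enn_powr (g x / G) a)"
        by (subst div[of F "f x"], use 3 in simp, use 3 in simp,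
            subst div[of G "g x"], use 3 in simp, use 3 in simp)
           (simp add: enn_powr_mult mult_ac)
      also have "\<dots> \<le> ?C * (ennreal (1 - a) * (f x / F) + ennreal a * (g x / G))"
        by (intro mult_left_mono enn_powr_Young a) auto
      finally show "enn_powr (f x) (1 - a) * enn_powr (g x) a
          \<le> ?C * (ennreal (1 - a) * (f x / F) + ennreal a * (g x / G))" .
    qed
    also have "\<dots> = ?C * (ennreal (1 - a) * (F / F) + ennreal a * (G / G))"
      by (simp add: nn_integral_cmult nn_integral_add nn_integral_divide F_def G_def)
    also have "\<dots> = ?C"
      using 3 a by (simp add: ennreal_divide_self less_top flip: ennreal_plus)
    finally show ?thesis by (simp add: F_def G_def)
  qed
qed

text \<open>Powers of norms, rather than norms, are the quantities that interpolate and integrate over time,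
  so the outer exponent \<open>1 / s\<close> is removed here and restored only at the end.\<close>
lemma wLnorm_powr:
  assumes "s \<noteq> 0"
  shows "enn_powr (wLnorm s w E v) s
     = (\<integral>\<^sup>+x. ennreal (norm (v x) powr s) \<partial>density (lebesgue_on E) (\<lambda>x. ennreal (w x)))"
  using assms by (simp add: wLnorm_def enn_powr_enn_powr)

text \<open>Hoelder's inequality is applied with respect to the weighted measure itself, whose
  measurable sets are the Lebesgue sets; so measurability of \<open>\<bar>v\<bar>\<close> carries over to it.\<close>
lemma wLnorm_interpolation:
  assumes v[measurable]: "(\<lambda>x. norm (v x)) \<in> borel_measurable (lebesgue_on E)"
    and a: "0 < a" "a < 1" and s: "0 < s" and r: "0 < r" and p: "p = s * (1 - a) + r * a"
  shows "enn_powr (wLnorm p w E v) p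
           \<le> enn_powr (wLnorm s w E v) (s * (1 - a)) * enn_powr (wLnorm r w E v) (r * a)"
proof -
  let ?M = "density (lebesgue_on E) (\<lambda>x. ennreal (w x))"
  have p0: "p \<noteq> 0"
    using a s r unfolding p by (smt (verit) mult_pos_pos)
  have pt: "ennreal (norm (v x) powr p)
      = enn_powr (ennreal (norm (v x) powr s)) (1 - a) * enn_powr (ennreal (norm (v x) powr r)) a" for x
    by (simp add: enn_powr_ennreal powr_powr p powr_add flip: ennreal_mult)
  have "enn_powr (wLnorm p w E v) p
      \<le> enn_powr (enn_powr (wLnorm s w E v) s) (1 - a) * enn_powr (enn_powr (wLnorm r w E v) r) a"
    using s r unfolding wLnorm_powr[OF p0] pt
    by (subst (1 2) wLnorm_powr) (auto intro!: nn_integral_Hoelder a)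
  then show ?thesis
    by (simp add: enn_powr_enn_powr)
qed

section \<open>Tonelli's theorem for Lebesgue measurable functions\<close>
lemma measurable_completion_cong_AE:
  assumes f: "f \<in> measurable (completion M) N" and ae: "AE x in M. f x = g x"
    and g: "g \<in> space M \<rightarrow> space N"
  shows "g \<in> measurable (completion M) N"
proof (rule measurableI)
  fix A assume "A \<in> sets N"
  then have A: "f -` A \<inter> space (completion M) \<in> sets (completion M)"
    by (rule measurable_sets[OF f])
  have "AE x in completion M. x \<in> f -` A \<inter> space (completion M) \<longleftrightarrow> x \<in> g -` A \<inter> space (completion M)"
    using AE_completion[OF ae] by eventually_elim auto
  then show "g -` A \<inter> space (completion M) \<in> sets (completion M)"
    by (rule completion.in_sets_AE[OF _ A]) auto
qed (use g in auto)

text \<open>The exceptional set is enclosed in a Borel null set first, because exchanging the two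
  almost-everywhere quantifiers requires measurability in the product.\<close>
lemma AE_lborel_slices:
  assumes "AE z in lborel. P z"
  shows "AE t in lborel :: 'b::euclidean_space measure.
           AE x in lborel :: 'a::euclidean_space measure. P (x, t)"
proof -
  obtain N where N[measurable]: "N \<in> sets borel" and "emeasure lborel N = 0" "{z. \<not> P z} \<subseteq> N"
    using assms unfolding eventually_ae_filter null_sets_def by auto
  then have "AE z in lborel. z \<notin> N"
    by (intro AE_not_in) (auto simp: null_sets_def)
  then have "AE z in (lborel :: 'a measure) \<Otimes>\<^sub>M (lborel :: 'b measure). z \<notin> N"
    unfolding lborel_prod .
  then have "AE x in (lborel :: 'a measure). AE t in (lborel :: 'b measure). (x, t) \<notin> N"
    by (auto dest!: lborel_pair.AE_pair)
  moreover have "{z \<in> space ((lborel :: 'a measure) \<Otimes>\<^sub>M (lborel :: 'b measure)). (fst z, snd z) \<notin> N}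
      \<in> sets ((lborel :: 'a measure) \<Otimes>\<^sub>M (lborel :: 'b measure))"
    using N unfolding lborel_prod by (simp flip: Compl_eq)
  ultimately have "AE t in (lborel :: 'b measure). AE x in (lborel :: 'a measure). (x, t) \<notin> N"
    by (subst (asm) lborel_pair.AE_commute) auto
  then show ?thesis
    by eventually_elim (use \<open>{z. \<not> P z} \<subseteq> N\<close> in \<open>auto elim!: eventually_mono\<close>)
qed

text \<open>All three parts are inherited from a Borel function \<open>g\<close> that equals \<open>f\<close> almost everywhere. A
  slice of \<open>f\<close> need not be measurable for the exceptional times, so measurability of the slices can
  only be asserted almost everywhere.\<close>
lemma lebesgue_Tonelli:
  fixes f :: "'a::euclidean_space \<times> 'b::euclidean_space \<Rightarrow> ennreal"
  assumes f: "f \<in> borel_measurable lebesgue"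
  shows "AE t in lebesgue. (\<lambda>x. f (x, t)) \<in> borel_measurable lebesgue"
    and "(\<lambda>t. \<integral>\<^sup>+x. f (x, t) \<partial>lebesgue) \<in> borel_measurable lebesgue"
    and "(\<integral>\<^sup>+t. (\<integral>\<^sup>+x. f (x, t) \<partial>lebesgue) \<partial>lebesgue) = (\<integral>\<^sup>+z. f z \<partial>lebesgue)"
proof -
  obtain g where g: "g \<in> borel_measurable lborel" and fg: "AE z in lborel. f z = g z"
    using completion_ex_borel_measurable[OF f] by auto
  have g2[measurable]: "g \<in> borel_measurable ((lborel :: 'a measure) \<Otimes>\<^sub>M (lborel :: 'b measure))"
    using g by (simp add: lborel_prod)
  have sl: "AE t in lborel. AE x in lborel. f (x, t) = g (x, t)"
    by (rule AE_lborel_slices[OF fg])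
  have int: "AE t in lborel. (\<integral>\<^sup>+x. g (x, t) \<partial>lborel) = (\<integral>\<^sup>+x. f (x, t) \<partial>lebesgue)"
    using sl unfolding nn_integral_completion
    by eventually_elim (auto intro!: nn_integral_cong_AE)
  have "AE t in lborel. (\<lambda>x. f (x, t)) \<in> borel_measurable lebesgue"
    using sl
  proof eventually_elim
    case (elim t)
    have "(\<lambda>x. g (x, t)) \<in> borel_measurable lebesgue"
      by (intro measurable_completion) measurable
    then show ?case
      by (rule measurable_completion_cong_AE) (use elim in auto)
  qed
  then show "AE t in lebesgue. (\<lambda>x. f (x, t)) \<in> borel_measurable lebesgue"
    by (rule AE_completion)
  have "(\<lambda>t. \<integral>\<^sup>+x. g (x, t) \<partial>lborel) \<in> borel_measurable lebesgue"
    by (intro measurable_completion) measurable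
  then show "(\<lambda>t. \<integral>\<^sup>+x. f (x, t) \<partial>lebesgue) \<in> borel_measurable lebesgue"
    by (rule measurable_completion_cong_AE) (use int in auto)
  have "(\<integral>\<^sup>+z. f z \<partial>lebesgue) = (\<integral>\<^sup>+z. g z \<partial>lborel)"
    unfolding nn_integral_completion using fg by (rule nn_integral_cong_AE)
  also have "\<dots> = (\<integral>\<^sup>+t. (\<integral>\<^sup>+x. g (x, t) \<partial>lborel) \<partial>lborel)"
    by (subst lborel_pair.nn_integral_snd[OF g2]) (simp add: lborel_prod)
  also have "\<dots> = (\<integral>\<^sup>+t. (\<integral>\<^sup>+x. f (x, t) \<partial>lebesgue) \<partial>lborel)"
    using int by (rule nn_integral_cong_AE)
  finally show "(\<integral>\<^sup>+t. (\<integral>\<^sup>+x. f (x, t) \<partial>lebesgue) \<partial>lebesgue) = (\<integral>\<^sup>+z. f z \<partial>lebesgue)"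
    by (simp add: nn_integral_completion)
qed

lemma lebesgue_on_Tonelli:
  fixes f :: "'a::euclidean_space \<times> 'b::euclidean_space \<Rightarrow> ennreal"
  assumes S: "S \<in> sets borel" and I: "I \<in> sets borel"
    and f: "f \<in> borel_measurable (lebesgue_on (S \<times> I))"
  shows "AE t in lebesgue_on I. (\<lambda>x. f (x, t)) \<in> borel_measurable (lebesgue_on S)"
    and "(\<lambda>t. \<integral>\<^sup>+x. f (x, t) \<partial>lebesgue_on S) \<in> borel_measurable (lebesgue_on I)"
    and "(\<integral>\<^sup>+t. (\<integral>\<^sup>+x. f (x, t) \<partial>lebesgue_on S) \<partial>lebesgue_on I) = (\<integral>\<^sup>+z. f z \<partial>lebesgue_on (S \<times> I))"
proof -
  define F where "F z = f z * indicator (S \<times> I) z" for z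
  have [simp]: "S \<in> sets lebesgue" "I \<in> sets lebesgue" "S \<times> I \<in> sets lebesgue"
    using S I borel_Times[OF S I] by auto
  have F: "F \<in> borel_measurable lebesgue"
    using f unfolding F_def by (subst (asm) borel_measurable_restrict_space_iff_ennreal) auto
  have F_slice: "F (x, t) = f (x, t) * indicator S x * indicator I t" for x t
    by (simp add: F_def indicator_times mult_ac)
  have F_int: "(\<integral>\<^sup>+x. F (x, t) \<partial>lebesgue) = (\<integral>\<^sup>+x. f (x, t) \<partial>lebesgue_on S) * indicator I t" for t
    by (simp add: F_slice nn_integral_restrict_space split: split_indicator)
  show "AE t in lebesgue_on I. (\<lambda>x. f (x, t)) \<in> borel_measurable (lebesgue_on S)"
    using lebesgue_Tonelli(1)[OF F]
    by (subst AE_restrict_space_iff, simp, eventually_elim)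
       (auto simp: borel_measurable_restrict_space_iff_ennreal F_slice)
  show "(\<lambda>t. \<integral>\<^sup>+x. f (x, t) \<partial>lebesgue_on S) \<in> borel_measurable (lebesgue_on I)"
    using lebesgue_Tonelli(2)[OF F] by (simp add: borel_measurable_restrict_space_iff_ennreal F_int)
  show "(\<integral>\<^sup>+t. (\<integral>\<^sup>+x. f (x, t) \<partial>lebesgue_on S) \<partial>lebesgue_on I) = (\<integral>\<^sup>+z. f z \<partial>lebesgue_on (S \<times> I))"
    using lebesgue_Tonelli(3)[OF F] F_int by (simp add: nn_integral_restrict_space F_def)
qed

text \<open>The cylinder over a null set is null, so a Borel function that equals \<open>w\<close> almost everywhere still
  equals it almost everywhere after both are lifted to the product.\<close>
lemma borel_measurable_lebesgue_on_fst:
  fixes w :: "'a::euclidean_space \<Rightarrow> ennreal" and I :: "'b::euclidean_space set"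
  assumes S: "S \<in> sets borel" and I: "I \<in> sets borel"
    and w: "w \<in> borel_measurable (lebesgue_on S)"
  shows "(\<lambda>z. w (fst z)) \<in> borel_measurable (lebesgue_on (S \<times> I))"
proof -
  define W where "W x = w x * indicator S x" for x
  have [simp]: "S \<in> sets lebesgue" "S \<times> I \<in> sets lebesgue"
    using S borel_Times[OF S I] by auto
  have "W \<in> borel_measurable lebesgue"
    using w unfolding W_def by (subst (asm) borel_measurable_restrict_space_iff_ennreal) auto
  then obtain g where g[measurable]: "g \<in> borel_measurable borel" and Wg: "AE x in lborel. W x = g x"
    using completion_ex_borel_measurable by force
  obtain N where N[measurable]: "N \<in> sets borel" and N0: "emeasure lborel N = 0" and NW: "{x. W x \<noteq> g x} \<subseteq> N"
    using Wg unfolding eventually_ae_filter null_sets_def by auto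
  have "AE x in lborel. x \<notin> N"
    using N N0 by (intro AE_not_in) (auto simp: null_sets_def)
  then have "AE z in (lborel :: 'a measure) \<Otimes>\<^sub>M (lborel :: 'b measure). fst z \<notin> N"
    by (intro lborel_pair.AE_pair_measure) (measurable, auto)
  then have ae: "AE z in (lborel :: ('a \<times> 'b) measure). fst z \<notin> N"
    unfolding lborel_prod .
  have "(\<lambda>z. g (fst z)) \<in> borel_measurable (lborel :: ('a \<times> 'b) measure)"
    by (simp flip: borel_prod)
  then have "(\<lambda>z. g (fst z)) \<in> borel_measurable (lebesgue :: ('a \<times> 'b) measure)"
    by (rule measurable_completion)
  moreover have "AE z in (lborel :: ('a \<times> 'b) measure). g (fst z) = W (fst z)"
    using ae by eventually_elim (use NW in force)
  ultimately have "(\<lambda>z. W (fst z)) \<in> borel_measurable (lebesgue :: ('a \<times> 'b) measure)"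
    by (rule measurable_completion_cong_AE) auto
  then have "(\<lambda>z. W (fst z) * indicator (S \<times> I) z) \<in> borel_measurable lebesgue"
    by (intro borel_measurable_times_ennreal borel_measurable_indicator) auto
  also have "(\<lambda>z. W (fst z) * indicator (S \<times> I) z) = (\<lambda>z. w (fst z) * indicator (S \<times> I) z)"
    by (auto simp: W_def split: split_indicator)
  finally show ?thesis
    by (simp add: borel_measurable_restrict_space_iff_ennreal)
qed

section \<open>Weighted norms on a cylinder and on its time slices\<close>

text \<open>A weighted norm is defined through a density, and integrals against a density unfold only for
  measurable integrands. At exceptional times the slice norm may thus differ from the integral of
  \<open>f\<close> below; completeness of Lebesgue measure absorbs these times.\<close>
lemma wLnorm_cylinder:
  fixes U :: "'a::euclidean_space set" and v :: "'a \<times> real \<Rightarrow> 'b::real_normed_vector"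
  assumes U: "U \<in> sets borel" and w: "w \<in> borel_measurable (lebesgue_on U)"
    and v: "(\<lambda>z. norm (v z)) \<in> borel_measurable (lebesgue_on (parabolic_cylinder U T))"
  shows "AE t in lebesgue_on {0<..<T}. (\<lambda>x. norm (v (x, t))) \<in> borel_measurable (lebesgue_on U)"
    and "s \<noteq> 0 \<Longrightarrow> (\<lambda>t. enn_powr (wLnorm s w U (\<lambda>x. v (x, t))) s) \<in> borel_measurable (lebesgue_on {0<..<T})"
    and "s \<noteq> 0 \<Longrightarrow> enn_powr (wLnorm s (\<lambda>(x, t). w x) (parabolic_cylinder U T) v) s
       = (\<integral>\<^sup>+t. enn_powr (wLnorm s w U (\<lambda>x. v (x, t))) s \<partial>lebesgue_on {0<..<T})"
proof -
  note v' = v[unfolded parabolic_cylinder_def]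
  have T: "{0<..<T} \<in> sets borel" by simp
  have w'[measurable]: "(\<lambda>x. ennreal (w x)) \<in> borel_measurable (lebesgue_on U)"
    using w by measurable
  have w_fst[measurable]: "(\<lambda>z. ennreal (w (fst z))) \<in> borel_measurable (lebesgue_on (U \<times> {0<..<T}))"
    by (rule borel_measurable_lebesgue_on_fst[OF U T w'])
  have "(\<lambda>z. ennreal (norm (v z))) \<in> borel_measurable (lebesgue_on (U \<times> {0<..<T}))"
    using v' by measurable
  from lebesgue_on_Tonelli(1)[OF U T this]
  show sl: "AE t in lebesgue_on {0<..<T}. (\<lambda>x. norm (v (x, t))) \<in> borel_measurable (lebesgue_on U)"
  proof eventually_elim
    case (elim t)
    \<comment> \<open>Tonelli's theorem speaks of extended reals; \<open>enn2real\<close> recovers the real slice.\<close>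
    then have "(\<lambda>x. enn2real (ennreal (norm (v (x, t))))) \<in> borel_measurable (lebesgue_on U)"
      by measurable
    then show ?case by simp
  qed
  assume s: "s \<noteq> 0"
  define f where "f z = ennreal (w (fst z)) * ennreal (norm (v z) powr s)" for z
  have f: "f \<in> borel_measurable (lebesgue_on (U \<times> {0<..<T}))"
    unfolding f_def using v' by measurable
  have eq: "AE t in lebesgue_on {0<..<T}.
      (\<integral>\<^sup>+x. f (x, t) \<partial>lebesgue_on U) = enn_powr (wLnorm s w U (\<lambda>x. v (x, t))) s"
    using sl
  proof eventually_elim
    case (elim t)
    then have "(\<lambda>x. ennreal (norm (v (x, t)) powr s)) \<in> borel_measurable (lebesgue_on U)"
      by measurable
    then show ?case
      by (simp add: wLnorm_powr s nn_integral_density f_def)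
  qed
  then have eq': "AE t in lborel. (\<integral>\<^sup>+x. f (x, t) \<partial>lebesgue_on U) * indicator {0<..<T} t
      = enn_powr (wLnorm s w U (\<lambda>x. v (x, t))) s * indicator {0<..<T} t"
    by (auto simp: AE_restrict_space_iff AE_completion_iff elim!: eventually_mono split: split_indicator)
  have "(\<lambda>t. (\<integral>\<^sup>+x. f (x, t) \<partial>lebesgue_on U) * indicator {0<..<T} t) \<in> borel_measurable lebesgue"
    using lebesgue_on_Tonelli(2)[OF U T f] by (simp add: borel_measurable_restrict_space_iff_ennreal)
  then have "(\<lambda>t. enn_powr (wLnorm s w U (\<lambda>x. v (x, t))) s * indicator {0<..<T} t) \<in> borel_measurable lebesgue"
    by (rule measurable_completion_cong_AE[OF _ eq']) auto
  then show "(\<lambda>t. enn_powr (wLnorm s w U (\<lambda>x. v (x, t))) s) \<in> borel_measurable (lebesgue_on {0<..<T})"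
    by (simp add: borel_measurable_restrict_space_iff_ennreal)
  have "enn_powr (wLnorm s (\<lambda>(x, t). w x) (parabolic_cylinder U T) v) s
      = (\<integral>\<^sup>+z. f z \<partial>lebesgue_on (U \<times> {0<..<T}))"
    using v' w_fst by (simp add: wLnorm_powr s nn_integral_density f_def parabolic_cylinder_def case_prod_beta)
  also have "\<dots> = (\<integral>\<^sup>+t. (\<integral>\<^sup>+x. f (x, t) \<partial>lebesgue_on U) \<partial>lebesgue_on {0<..<T})"
    by (rule lebesgue_on_Tonelli(3)[OF U T f, symmetric])
  also have "\<dots> = (\<integral>\<^sup>+t. enn_powr (wLnorm s w U (\<lambda>x. v (x, t))) s \<partial>lebesgue_on {0<..<T})"
    using eq by (rule nn_integral_cong_AE)
  finally show "enn_powr (wLnorm s (\<lambda>(x, t). w x) (parabolic_cylinder U T) v) s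
       = (\<integral>\<^sup>+t. enn_powr (wLnorm s w U (\<lambda>x. v (x, t))) s \<partial>lebesgue_on {0<..<T})" .
qed

section \<open>The parabolic embedding inequality\<close>

theorem lemma2p1:
  fixes U :: "(real ^ 'n) set"
    and \<gamma>1 \<gamma>2 :: "real ^ 'n \<Rightarrow> real"
    and X :: "(real ^ 'n \<Rightarrow> real) set"
    and r q c0 p T :: real
    and u :: "(real ^ 'n) \<times> real \<Rightarrow> real"
    and Du :: "(real ^ 'n) \<times> real \<Rightarrow> real ^ 'n"
  assumes dim: "CARD('n) \<ge> 2"
    and dom: "bounded_C1_domain U"
    and \<gamma>1_meas: "\<gamma>1 \<in> borel_measurable (lebesgue_on U)" and \<gamma>1_pos: "\<forall>x\<in>U. \<gamma>1 x > 0"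
    and \<gamma>2_meas: "\<gamma>2 \<in> borel_measurable (lebesgue_on U)" and \<gamma>2_pos: "\<forall>x\<in>U. \<gamma>2 x > 0"
    and r_gt_2: "r > 2" and r_gt_q: "r > q" and q_ge_1: "q \<ge> 1"
    and X_vanish: "\<forall>v\<in>X. vanishes_on_boundary U v"
    and X_grad: "\<forall>v\<in>X. \<exists>g. has_weak_gradient U v g"
    and c0_pos: "c0 > 0"
    and X_ineq: "\<forall>v\<in>X. \<forall>g. has_weak_gradient U v g \<longrightarrow>
                   wLnorm r \<gamma>1 U v \<le> ennreal c0 * wLnorm q \<gamma>2 U g"
    and p_eq: "p = 2 + q * (1 - 2 / r)"
    and T_pos: "T > 0"
    and u_meas: "u \<in> borel_measurable (lebesgue_on (parabolic_cylinder U T))"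
    and u_class: "u \<in> parabolic_class X T"
    and u_grad: "has_spatial_weak_gradient U T u Du"
  shows "p = q + 2 * (1 - q / r)
    \<and> wLnorm p (\<lambda>(x, t). \<gamma>1 x) (parabolic_cylinder U T) u
         \<le> ennreal (c0 powr (q / p))
           * enn_powr (esssup (lebesgue_on {0<..<T}) (\<lambda>t. wLnorm 2 \<gamma>1 U (\<lambda>x. u (x, t)))) (1 - q / p)
           * enn_powr (wLnorm q (\<lambda>(x, t). \<gamma>2 x) (parabolic_cylinder U T) Du) (q / p)
    \<and> wLnorm p (\<lambda>(x, t). \<gamma>1 x) (parabolic_cylinder U T) u
         \<le> ennreal (c0 powr (q / p))
           * (esssup (lebesgue_on {0<..<T}) (\<lambda>t. wLnorm 2 \<gamma>1 U (\<lambda>x. u (x, t)))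
              + wLnorm q (\<lambda>(x, t). \<gamma>2 x) (parabolic_cylinder U T) Du)"
proof -
  define a where "a = q / r"
  have a: "0 < a" "a < 1"
    using r_gt_q q_ge_1 by (auto simp: a_def)
  have ra: "r * a = q"
    using r_gt_2 by (simp add: a_def)
  have p: "p = 2 * (1 - a) + r * a"
    unfolding ra using p_eq by (simp add: a_def algebra_simps)
  have p0: "p > 0" and qp: "0 < q / p" "q / p < 1"
    using p a q_ge_1 by (auto simp: ra)
  have "2 * (1 - a) = p - q"
    using p ra by simp
  then have exps: "2 * (1 - a) / p = 1 - q / p"
    using p0 by (simp add: diff_divide_distrib)
  have U: "U \<in> sets borel"
    using dom by (auto simp: bounded_C1_domain_def)
  define I where "I = lebesgue_on {0<..<T}"
  define A where "A = esssup I (\<lambda>t. wLnorm 2 \<gamma>1 U (\<lambda>x. u (x, t)))"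
  define L where "L = wLnorm p (\<lambda>(x, t). \<gamma>1 x) (parabolic_cylinder U T) u"
  define D where "D = wLnorm q (\<lambda>(x, t). \<gamma>2 x) (parabolic_cylinder U T) Du"
  have nu: "(\<lambda>z. norm (u z)) \<in> borel_measurable (lebesgue_on (parabolic_cylinder U T))"
    using u_meas by measurable
  have nDu: "(\<lambda>z. norm (Du z)) \<in> borel_measurable (lebesgue_on (parabolic_cylinder U T))"
    using u_grad unfolding has_spatial_weak_gradient_def by (auto intro: borel_measurable_norm)
  \<comment> \<open>The interpolation and the Sobolev-type inequality combine at almost every time.\<close>
  have "AE t in I. wLnorm 2 \<gamma>1 U (\<lambda>x. u (x, t)) \<le> A"
    unfolding A_def by (rule esssup_AE)
  moreover have "AE t in I. (\<lambda>x. u (x, t)) \<in> X"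
    using u_class unfolding parabolic_class_def I_def by simp
  moreover have "AE t in I. has_weak_gradient U (\<lambda>x. u (x, t)) (\<lambda>x. Du (x, t))"
    using u_grad unfolding has_spatial_weak_gradient_def I_def by simp
  moreover have "AE t in I. (\<lambda>x. norm (u (x, t))) \<in> borel_measurable (lebesgue_on U)"
    unfolding I_def by (rule wLnorm_cylinder(1)[OF U \<gamma>1_meas nu])
  ultimately have slice: "AE t in I. enn_powr (wLnorm p \<gamma>1 U (\<lambda>x. u (x, t))) p
      \<le> enn_powr A (2 * (1 - a)) * ennreal (c0 powr q) * enn_powr (wLnorm q \<gamma>2 U (\<lambda>x. Du (x, t))) q"
  proof eventually_elim
    case (elim t)
    have "enn_powr (wLnorm p \<gamma>1 U (\<lambda>x. u (x, t))) p
        \<le> enn_powr (wLnorm 2 \<gamma>1 U (\<lambda>x. u (x, t))) (2 * (1 - a)) * enn_powr (wLnorm r \<gamma>1 U (\<lambda>x. u (x, t))) (r * a)"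
      using elim(4) a r_gt_2 p by (intro wLnorm_interpolation) auto
    also have "\<dots> \<le> enn_powr A (2 * (1 - a)) * enn_powr (ennreal c0 * wLnorm q \<gamma>2 U (\<lambda>x. Du (x, t))) q"
      unfolding ra using elim X_ineq a q_ge_1 by (intro mult_mono enn_powr_mono) auto
    finally show ?case
      using c0_pos by (simp add: enn_powr_mult enn_powr_ennreal mult.assoc)
  qed
  have "enn_powr L p = (\<integral>\<^sup>+t. enn_powr (wLnorm p \<gamma>1 U (\<lambda>x. u (x, t))) p \<partial>I)"
    unfolding L_def I_def using p0 by (intro wLnorm_cylinder(3)[OF U \<gamma>1_meas nu]) auto
  also have "\<dots> \<le> (\<integral>\<^sup>+t. enn_powr A (2 * (1 - a)) * ennreal (c0 powr q) * enn_powr (wLnorm q \<gamma>2 U (\<lambda>x. Du (x, t))) q \<partial>I)"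
    using slice by (rule nn_integral_mono_AE)
  also have "\<dots> = enn_powr A (2 * (1 - a)) * ennreal (c0 powr q) * (\<integral>\<^sup>+t. enn_powr (wLnorm q \<gamma>2 U (\<lambda>x. Du (x, t))) q \<partial>I)"
    unfolding I_def using q_ge_1 by (intro nn_integral_cmult wLnorm_cylinder(2)[OF U \<gamma>2_meas nDu]) auto
  also have "(\<integral>\<^sup>+t. enn_powr (wLnorm q \<gamma>2 U (\<lambda>x. Du (x, t))) q \<partial>I) = enn_powr D q"
    unfolding D_def I_def using q_ge_1 by (intro wLnorm_cylinder(3)[OF U \<gamma>2_meas nDu, symmetric]) auto
  finally have "enn_powr (enn_powr L p) (1 / p)
      \<le> enn_powr (enn_powr A (2 * (1 - a)) * ennreal (c0 powr q) * enn_powr D q) (1 / p)"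
    using p0 by (intro enn_powr_mono) auto
  then have main: "L \<le> ennreal (c0 powr (q / p)) * enn_powr A (1 - q / p) * enn_powr D (q / p)"
    using p0 exps by (simp add: enn_powr_mult enn_powr_enn_powr enn_powr_ennreal powr_powr mult_ac)
  \<comment> \<open>Both factors are at most powers of the sum, and the two exponents add up to one.\<close>
  have "enn_powr A (1 - q / p) * enn_powr D (q / p) \<le> enn_powr (A + D) (1 - q / p) * enn_powr (A + D) (q / p)"
    using qp by (intro mult_mono enn_powr_mono) auto
  also have "\<dots> = A + D"
    by (simp add: enn_powr_add)
  finally have "L \<le> ennreal (c0 powr (q / p)) * (A + D)"
    by (intro order_trans[OF main]) (simp add: mult.assoc mult_left_mono)
  moreover have "p = q + 2 * (1 - q / r)"
    unfolding p_eq by (simp add: algebra_simps)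
  ultimately show ?thesis
    using main unfolding L_def A_def D_def I_def by blast
qed

end
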